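(* Let $k\ge 1$ be an integer and let $\alpha<H(n_{k-1})$. Then there exist a positive integer $\beta$ and a uniform metric space (one with $n_{k-1}+1$ points suffices) such that no randomized online algorithm for the weighted $k$-server problem on this space with server weights $1,\beta,\beta^2,\ldots,\beta^{k-1}$ is $\alpha$-competitive against an oblivious adversary. In particular, the randomized competitive ratio of weighted $k$-server on uniform metric spaces is at least $H(n_{k-1})$.
   Context: The sequence $n_0,n_1,\ldots$ is defined by $n_0=1$ and, for $i>0$, $n_i=\left(\lceil n_{i-1}/2\rceil+1\right)\cdot\left(\lfloor n_{i-1}/2\rfloor+1\right)$. $H(n)=\sum_{i=1}^n 1/i$ denotes the $n$-th harmonic number. Weighted $k$-server problem on a uniform metric space (all distinct points at distance $1$): there are $k$ servers with weights $w_1\le\cdots\le w_k$, each located at a point of the space, starting from a given initial configuration. Requests (points of the space) arrive one at a time; when a point is requested, a server must be at that point after serving it (servers may be moved at any time), and moving server $i$ to a different point costs $w_i$. An online algorithm decides its movements knowing only the requests so far. A randomized online algorithm is $c$-competitive against an oblivious adversary if on every request sequence (fixed in advance, independent of the algorithm's random choices) and every initial configuration, its expected cost is at most $c$ times the optimal (offline) cost of serving that sequence from the same initial configuration. *)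

theory Defs
  imports "HOL-Probability.Probability" "HOL-Analysis.Harmonic_Numbers"
begin

fun nseq :: "nat \<Rightarrow> nat" where
  "nseq 0 = 1"
| "nseq (Suc i) = ((nseq i + 1) div 2 + 1) * (nseq i div 2 + 1)"

text \<open>Uniform metric space with N points, represented as {0..<N}.
  Servers are indexed 0..<k (server i has weight w i); a configuration
  maps each server to a point.\<close>
type_synonym config = "nat \<Rightarrow> nat"

text \<open>A deterministic online algorithm: given the initial configuration and the
  prefix of requests seen so far, it returns the configuration after serving
  the last request of the prefix.\<close>
type_synonym det_alg = "config \<Rightarrow> nat list \<Rightarrow> config"

definition valid_config :: "nat \<Rightarrow> nat \<Rightarrow> config \<Rightarrow> bool" where
  "valid_config k N c \<longleftrightarrow> (\<forall>i<k. c i < N)"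

definition serves :: "nat \<Rightarrow> config \<Rightarrow> nat \<Rightarrow> bool" where
  "serves k c p \<longleftrightarrow> (\<exists>i<k. c i = p)"

definition move_cost :: "nat \<Rightarrow> (nat \<Rightarrow> real) \<Rightarrow> config \<Rightarrow> config \<Rightarrow> real" where
  "move_cost k w c c' = (\<Sum>i<k. if c i \<noteq> c' i then w i else 0)"

definition online_alg :: "nat \<Rightarrow> nat \<Rightarrow> det_alg \<Rightarrow> bool" where
  "online_alg k N A \<longleftrightarrow>
     (\<forall>c0 xs. valid_config k N c0 \<and> set xs \<subseteq> {..<N} \<longrightarrow>
        A c0 [] = c0 \<and> valid_config k N (A c0 xs) \<and>
        (xs \<noteq> [] \<longrightarrow> serves k (A c0 xs) (last xs)))"

definition alg_cost :: "nat \<Rightarrow> (nat \<Rightarrow> real) \<Rightarrow> det_alg \<Rightarrow> config \<Rightarrow> nat list \<Rightarrow> real" where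
  "alg_cost k w A c0 \<sigma> =
     (\<Sum>t<length \<sigma>. move_cost k w (A c0 (take t \<sigma>)) (A c0 (take (Suc t) \<sigma>)))"

definition feasible :: "nat \<Rightarrow> nat \<Rightarrow> nat list \<Rightarrow> config list \<Rightarrow> bool" where
  "feasible k N \<sigma> cs \<longleftrightarrow> length cs = length \<sigma> \<and>
     (\<forall>t<length \<sigma>. valid_config k N (cs ! t) \<and> serves k (cs ! t) (\<sigma> ! t))"

definition sched_cost :: "nat \<Rightarrow> (nat \<Rightarrow> real) \<Rightarrow> config \<Rightarrow> config list \<Rightarrow> real" where
  "sched_cost k w c0 cs = (\<Sum>t<length cs. move_cost k w ((c0 # cs) ! t) (cs ! t))"

definition opt_cost :: "nat \<Rightarrow> nat \<Rightarrow> (nat \<Rightarrow> real) \<Rightarrow> config \<Rightarrow> nat list \<Rightarrow> real" where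
  "opt_cost k N w c0 \<sigma> = Inf {sched_cost k w c0 cs | cs. feasible k N \<sigma> cs}"

definition rand_alg :: "nat \<Rightarrow> nat \<Rightarrow> det_alg measure \<Rightarrow> bool" where
  "rand_alg k N M \<longleftrightarrow> prob_space M \<and> (\<forall>A\<in>space M. online_alg k N A) \<and>
     (\<forall>c0 xs i. (\<lambda>A. A c0 xs i) \<in> measurable M (count_space UNIV))"

text \<open>c-competitive against an oblivious adversary (no additive constant, as in
  the paper's definition).\<close>
definition competitive :: "nat \<Rightarrow> nat \<Rightarrow> (nat \<Rightarrow> real) \<Rightarrow> det_alg measure \<Rightarrow> real \<Rightarrow> bool" where
  "competitive k N w M c \<longleftrightarrow>
     (\<forall>c0 \<sigma>. valid_config k N c0 \<and> set \<sigma> \<subseteq> {..<N} \<longrightarrow>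
        (\<integral>A. alg_cost k w A c0 \<sigma> \<partial>M) \<le> c * opt_cost k N w c0 \<sigma>)"

end

theory Submission
  imports Defs
begin

text \<open>By Yao's principle it suffices to exhibit a random request sequence that is expensive for
  every deterministic online algorithm but cheap offline.

  By induction on \<open>l\<close>, every set \<open>S\<close> of \<open>nseq l\<close> points carries a random request sequence, the gadget
  of level \<open>l\<close>, that costs about \<open>\<beta> ^ l\<close> online if none of the servers \<open>l, l + 1, \<dots>\<close> is in \<open>S\<close>,
  but only \<open>O(\<beta> ^ (l - 1))\<close> offline if one of them is. The gadget of level \<open>l + 1\<close> consists of
  \<open>O(\<beta>)\<close> gadgets of level \<open>l\<close> on random members of a family \<open>F\<close> of subsets of \<open>S\<close> such that every
  point is missed by some member of \<open>F\<close> (so server \<open>l\<close> is repeatedly in the wrong place), whereas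
  every point of \<open>S\<close> has a partner in \<open>S\<close> with which it hits all members of \<open>F\<close> (so offline,
  server \<open>l\<close> moves only once).

  Finally, run gadgets of level \<open>k - 1\<close> on the complements of independent uniform points \<open>p\<close> of
  the whole space of \<open>N = nseq (k - 1) + 1\<close> points. The heaviest server of the algorithm is at \<open>p\<close>
  with probability \<open>1 / N\<close> and then the algorithm pays about \<open>\<beta> ^ (k - 1)\<close>. Offline, the heaviest
  server moves once per coupon collector phase, which has expected length \<open>N * harm (N - 1)\<close>.\<close>

section \<open>Expectations over finitely supported distributions and i.i.d. lists\<close>

lemma expectation_mono_pmf:
  fixes f g :: "'a \<Rightarrow> real"
  assumes "finite (set_pmf p)" "\<And>x. x \<in> set_pmf p \<Longrightarrow> f x \<le> g x"
  shows "measure_pmf.expectation p f \<le> measure_pmf.expectation p g"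
  using assms by (intro integral_mono_AE) (auto simp: AE_measure_pmf_iff integrable_measure_pmf_finite)

lemma expectation_bind_pmf:
  fixes h :: "'b \<Rightarrow> real"
  assumes "finite (set_pmf p)" "\<And>x. x \<in> set_pmf p \<Longrightarrow> finite (set_pmf (f x))"
  shows "measure_pmf.expectation (bind_pmf p f) h =
         measure_pmf.expectation p (\<lambda>x. measure_pmf.expectation (f x) h)"
proof -
  have "measure_pmf.expectation (bind_pmf p f) h =
      (\<Sum>a\<in>set_pmf p. pmf p a *\<^sub>R measure_pmf.expectation (f a) h)"
    using assms by (intro pmf_expectation_bind) auto
  also have "\<dots> = measure_pmf.expectation p (\<lambda>x. measure_pmf.expectation (f x) h)"
    using assms by (intro integral_measure_pmf[symmetric]) auto
  finally show ?thesis .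
qed

lemma finite_set_replicate_pmf:
  assumes "finite (set_pmf p)"
  shows "finite (set_pmf (replicate_pmf n p))"
  using assms by (induction n) auto

lemma set_replicate_pmfD:
  assumes "xs \<in> set_pmf (replicate_pmf n p)"
  shows "length xs = n" "set xs \<subseteq> set_pmf p"
  using assms by (auto simp: set_replicate_pmf)

lemma expectation_replicate_pmf_Suc:
  fixes h :: "'a list \<Rightarrow> real"
  assumes "finite (set_pmf p)"
  shows "measure_pmf.expectation (replicate_pmf (Suc n) p) h =
     measure_pmf.expectation p (\<lambda>x. measure_pmf.expectation (replicate_pmf n p) (\<lambda>xs. h (x # xs)))"
  using assms
  by (simp add: expectation_bind_pmf finite_set_replicate_pmf map_pmf_def[symmetric] bind_return_pmf')

section \<open>Online cost of a block of requests after a given history\<close>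

text \<open>The history \<open>h\<close> is an argument because an algorithm may treat the same
  block differently after different histories. This form makes costs additive over consecutive
  blocks, and the free weights \<open>w\<close> allow capped and true costs to be compared.\<close>

fun path_cost :: "nat \<Rightarrow> (nat \<Rightarrow> real) \<Rightarrow> (nat list \<Rightarrow> config) \<Rightarrow> nat list \<Rightarrow> nat list \<Rightarrow> real" where
  "path_cost k w g h [] = 0"
| "path_cost k w g h (x # s) = move_cost k w (g h) (g (h @ [x])) + path_cost k w g (h @ [x]) s"

lemma path_cost_append:
  "path_cost k w g h (s @ t) = path_cost k w g h s + path_cost k w g (h @ s) t"
  by (induction s arbitrary: h) auto

lemma alg_cost_eq_path_cost: "alg_cost k w A c0 s = path_cost k w (A c0) [] s"
proof -
  have "path_cost k w g h s =
      (\<Sum>t<length s. move_cost k w (g (h @ take t s)) (g (h @ take (Suc t) s)))" for g h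
    by (induction s arbitrary: h) (auto simp: sum.lessThan_Suc_shift simp del: sum.lessThan_Suc)
  then show ?thesis by (simp add: alg_cost_def)
qed

lemma move_cost_nonneg: "(\<And>i. w i \<ge> 0) \<Longrightarrow> move_cost k w c c' \<ge> 0"
  by (auto simp: move_cost_def intro!: sum_nonneg)

lemma path_cost_nonneg: "(\<And>i. w i \<ge> 0) \<Longrightarrow> path_cost k w g h s \<ge> 0"
  by (induction s arbitrary: h) (auto simp: move_cost_nonneg)

lemma move_cost_mono: "(\<And>i. w i \<le> w' i) \<Longrightarrow> move_cost k w c c' \<le> move_cost k w' c c'"
  by (auto simp: move_cost_def intro!: sum_mono)

lemma path_cost_mono: "(\<And>i. w i \<le> w' i) \<Longrightarrow> path_cost k w g h s \<le> path_cost k w' g h s"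
  by (induction s arbitrary: h) (auto intro!: add_mono move_cost_mono)

lemma move_cost_ge_weight:
  assumes "\<And>i. w i \<ge> 0" "i < k" "c i \<noteq> c' i"
  shows "w i \<le> move_cost k w c c'"
proof -
  have "(if c i \<noteq> c' i then w i else 0) \<le> move_cost k w c c'"
    unfolding move_cost_def using assms by (intro member_le_sum) auto
  then show ?thesis using assms by simp
qed

lemma move_cost_diff:
  "move_cost k w' c c' - move_cost k w c c' = move_cost k (\<lambda>i. w' i - w i) c c'"
  by (auto simp: move_cost_def sum_subtractf[symmetric] intro!: sum.cong)

text \<open>Cost is linear in the weights. Hence the excess of one weighting over a smaller one is
  again a path cost, and a single server that ends elsewhere bounds it from below.\<close>

lemma path_cost_diff:
  "path_cost k w' g h s - path_cost k w g h s = path_cost k (\<lambda>i. w' i - w i) g h s"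
  by (induction s arbitrary: h) (auto simp: move_cost_diff[symmetric] algebra_simps)

lemma path_cost_ge_weight:
  assumes "\<And>i. w i \<ge> 0" "i < k" "g h i \<noteq> g (h @ s) i"
  shows "w i \<le> path_cost k w g h s"
  using assms(3)
proof (induction s arbitrary: h)
  case (Cons x s)
  show ?case
  proof (cases "g h i = g (h @ [x]) i")
    case True
    then have "w i \<le> path_cost k w g (h @ [x]) s" using Cons by auto
    with move_cost_nonneg[OF assms(1)] show ?thesis by (simp add: add_increasing)
  next
    case False
    then have "w i \<le> move_cost k w (g h) (g (h @ [x]))"
      using assms by (intro move_cost_ge_weight) auto
    with path_cost_nonneg[OF assms(1)] show ?thesis by (simp add: add_increasing2)
  qed
qed simp

lemma move_cost_fun_upd_le:
  assumes "w i \<ge> 0"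
  shows "move_cost k w c (c(i := p)) \<le> w i"
proof -
  have "move_cost k w c (c(i := p)) \<le> (\<Sum>j<k. if j = i then w i else 0)"
    unfolding move_cost_def using assms by (intro sum_mono) auto
  also have "\<dots> \<le> w i" using assms by simp
  finally show ?thesis .
qed

lemma move_cost_triangle:
  assumes "\<And>i. w i \<ge> 0"
  shows "move_cost k w a c \<le> move_cost k w a b + move_cost k w b c"
  unfolding move_cost_def sum.distrib[symmetric] using assms by (intro sum_mono) auto

text \<open>\<open>D\<close> is what the algorithm must pay, on top of the cheap cost \<open>e\<close>, to leave the
  states \<open>G\<close> in which a block is expected to be expensive.\<close>
lemma expectation_path_cost_iid_blocks:
  fixes B :: "'b pmf" and e :: "nat list \<Rightarrow> nat list \<Rightarrow> real"
  assumes fin: "finite (set_pmf B)"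
    and w: "\<And>i. w i \<ge> 0"
    and block: "\<And>h. G h \<Longrightarrow> measure_pmf.expectation B (\<lambda>x. e h (f x)) \<ge> \<delta>"
    and cheap: "\<And>h x. G h \<Longrightarrow> x \<in> set_pmf B \<Longrightarrow> e h (f x) \<le> path_cost k w g h (f x)"
    and leave: "\<And>h x. G h \<Longrightarrow> x \<in> set_pmf B \<Longrightarrow> \<not> G (h @ f x) \<Longrightarrow>
                  e h (f x) + D \<le> path_cost k w g h (f x)"
    and D: "\<And>j. j < m \<Longrightarrow> real j * \<delta> \<le> D"
    and h: "G h" and j: "j \<le> m"
  shows "real j * \<delta> \<le>
    measure_pmf.expectation (replicate_pmf j B) (\<lambda>xs. path_cost k w g h (concat (map f xs)))"
  using h j
proof (induction j arbitrary: h)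
  case (Suc j)
  let ?E = "\<lambda>h. measure_pmf.expectation (replicate_pmf j B) (\<lambda>xs. path_cost k w g h (concat (map f xs)))"
  have fin': "finite (set_pmf (replicate_pmf j B))" by (rule finite_set_replicate_pmf[OF fin])
  have "real (Suc j) * \<delta> \<le> measure_pmf.expectation B (\<lambda>x. e h (f x)) + real j * \<delta>"
    using block[OF Suc.prems(1)] by (simp add: algebra_simps)
  also have "\<dots> = measure_pmf.expectation B (\<lambda>x. e h (f x) + real j * \<delta>)"
    by (simp add: integrable_measure_pmf_finite[OF fin])
  also have "\<dots> \<le> measure_pmf.expectation B (\<lambda>x. path_cost k w g h (f x) + ?E (h @ f x))"
  proof (rule expectation_mono_pmf[OF fin])
    fix x assume x: "x \<in> set_pmf B"
    show "e h (f x) + real j * \<delta> \<le> path_cost k w g h (f x) + ?E (h @ f x)"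
    proof (cases "G (h @ f x)")
      case True
      then show ?thesis using Suc.IH[OF True] Suc.prems cheap[OF Suc.prems(1) x] by simp
    next
      \<comment> \<open>After \<open>G\<close> is left, the later blocks are only known to cost at
        least 0. The surcharge \<open>D\<close> already covers all \<open>j\<close> of them, since
        \<open>j < m\<close>.\<close>
      case False
      have "0 \<le> ?E (h @ f x)" by (intro Bochner_Integration.integral_nonneg path_cost_nonneg w)
      then show ?thesis using leave[OF Suc.prems(1) x False] D[of j] Suc.prems by simp
    qed
  qed
  also have "\<dots> = measure_pmf.expectation (replicate_pmf (Suc j) B)
      (\<lambda>xs. path_cost k w g h (concat (map f xs)))"
    unfolding expectation_replicate_pmf_Suc[OF fin]
    by (simp add: path_cost_append integrable_measure_pmf_finite[OF fin'])
  finally show ?case .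
qed simp

section \<open>Offline schedules and the optimal cost\<close>

text \<open>Moving and serving are separate rules, so that a relocation can be put in front of any
  schedule and schedules of consecutive blocks compose through their end configurations with costs
  adding up.\<close>

inductive offline :: "nat \<Rightarrow> nat \<Rightarrow> (nat \<Rightarrow> real) \<Rightarrow> config \<Rightarrow> nat list \<Rightarrow> real \<Rightarrow> config \<Rightarrow> bool"
  for k N w where
  stop: "offline k N w c [] 0 c"
| move: "valid_config k N c1 \<Longrightarrow> offline k N w c1 s x c' \<Longrightarrow>
    offline k N w c s (move_cost k w c c1 + x) c'"
| serve: "valid_config k N c \<Longrightarrow> serves k c p \<Longrightarrow> offline k N w c s x c' \<Longrightarrow>
    offline k N w c (p # s) x c'"

lemma offline_append:
  assumes "offline k N w c s x c'" "offline k N w c' t y c''"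
  shows "offline k N w c (s @ t) (x + y) c''"
  using assms by (induction) (auto simp: add.assoc intro: offline.intros)

lemma move_cost_refl [simp]: "move_cost k w c c = 0"
  by (simp add: move_cost_def)

lemma sched_cost_Cons:
  "sched_cost k w c (d # cs) = move_cost k w c d + sched_cost k w d cs"
  unfolding sched_cost_def by (simp add: sum.lessThan_Suc_shift del: sum.lessThan_Suc)

lemma sched_cost_nonneg: "(\<And>i. w i \<ge> 0) \<Longrightarrow> sched_cost k w c cs \<ge> 0"
  by (auto simp: sched_cost_def move_cost_nonneg intro!: sum_nonneg)

lemma sched_cost_move_first:
  assumes "\<And>i. w i \<ge> 0"
  shows "sched_cost k w c cs \<le> move_cost k w c d + sched_cost k w d cs"
proof (cases cs)
  case Nil
  then show ?thesis using move_cost_nonneg[of w k c d, OF assms] by (simp add: sched_cost_def)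
next
  case (Cons e cs')
  then show ?thesis using move_cost_triangle[of w k c e d, OF assms] by (simp add: sched_cost_Cons)
qed

text \<open>\<open>feasible\<close> allows one configuration per request, so successive moves are
  merged and moves after the last request dropped. By the triangle inequality this can only lower
  the cost, hence the inequality.\<close>

lemma offline_schedule:
  assumes "offline k N w c s x c'" and w: "\<And>i. w i \<ge> 0"
  shows "\<exists>cs. feasible k N s cs \<and> sched_cost k w c cs \<le> x"
  using assms(1)
proof induction
  case (stop c)
  show ?case by (intro exI[of _ "[]"]) (simp add: feasible_def sched_cost_def)
next
  case (move c1 s x c' c)
  then obtain cs where "feasible k N s cs" "sched_cost k w c1 cs \<le> x" by blast
  then show ?case using sched_cost_move_first[of w k c cs c1, OF w] by (intro exI[of _ cs]) simp
next
  case (serve c p s x c')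
  then obtain cs where "feasible k N s cs" "sched_cost k w c cs \<le> x" by blast
  then show ?case using serve.hyps
    by (intro exI[of _ "c # cs"]) (auto simp: feasible_def sched_cost_Cons nth_Cons split: nat.split)
qed

lemma opt_cost_le_offline:
  assumes "offline k N w c s x c'" and w: "\<And>i. w i \<ge> 0"
  shows "opt_cost k N w c s \<le> x"
proof -
  obtain cs where cs: "feasible k N s cs" "sched_cost k w c cs \<le> x"
    using offline_schedule[OF assms] by blast
  have "opt_cost k N w c s \<le> sched_cost k w c cs"
    unfolding opt_cost_def using cs sched_cost_nonneg[of w k c, OF w]
    by (intro cInf_lower bdd_belowI[of _ 0]) auto
  with cs show ?thesis by simp
qed

text \<open>The given schedule makes the set of feasible costs nonempty, without which a lower bound
  on its members says nothing about \<open>Inf\<close>.\<close>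

lemma opt_cost_nonneg:
  assumes "offline k N w c s x c'" and w: "\<And>i. w i \<ge> 0"
  shows "0 \<le> opt_cost k N w c s"
  unfolding opt_cost_def using offline_schedule[OF assms] sched_cost_nonneg[of w k c, OF w]
  by (intro cInf_greatest) auto

section \<open>The set system behind the recursion of \<open>nseq\<close>\<close>

definition width :: "nat \<Rightarrow> nat" where
  "width l = (nseq l + 1) div 2 + 1"

lemma width_pos: "width l > 0"
  by (simp add: width_def)

lemma nseq_pos: "nseq l \<ge> 1"
  by (induction l) auto

text \<open>View \<open>S\<close> as a grid with \<open>a\<close> rows and \<open>b\<close> columns. The \<open>i\<close>-th set consists of the
  first column without its \<open>i\<close>-th entry, together with the rest of the \<open>i\<close>-th row.\<close>
lemma set_system:
  fixes S :: "nat set"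
  assumes "finite S" "card S = nseq (Suc l)"
  shows "\<exists>F. finite F \<and> card F \<le> width l \<and> (\<forall>Q\<in>F. Q \<subseteq> S \<and> card Q = nseq l) \<and>
    (\<forall>p. \<exists>Q\<in>F. p \<notin> Q) \<and> (\<forall>p\<in>S. \<exists>q\<in>S. \<forall>Q\<in>F. p \<in> Q \<or> q \<in> Q)"
proof -
  define a where "a = width l"
  define b where "b = nseq l div 2 + 1"
  have a2: "a \<ge> 2" using nseq_pos[of l] unfolding a_def width_def by simp
  have b1: "b \<ge> 1" unfolding b_def by simp
  \<comment> \<open>A single column forces \<open>nseq l = 1\<close>, hence exactly two rows. This
    settles the degenerate case in the choice of \<open>z'\<close> below.\<close>
  have a_eq: "a = 2" if "b = 1" using that nseq_pos[of l] unfolding a_def b_def width_def by auto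
  have ab: "(a - 1) + (b - 1) = nseq l" unfolding a_def b_def width_def by simp
  have "card ({..<a} \<times> {..<b}) = card S" using assms by (simp add: a_def b_def width_def)
  then obtain g where g: "bij_betw g ({..<a} \<times> {..<b}) S"
    using finite_same_card_bij[of "{..<a} \<times> {..<b}" S] assms by auto
  define D where "D i = ({..<a} - {i}) \<times> {0} \<union> {i} \<times> {1..<b}" for i
  have D: "D i \<subseteq> {..<a} \<times> {..<b}" if "i < a" for i using that b1 by (auto simp: D_def)
  have inj: "inj_on g ({..<a} \<times> {..<b})" and im: "g ` ({..<a} \<times> {..<b}) = S"
    using g by (auto simp: bij_betw_def)
  have mem: "g z \<in> g ` D i \<longleftrightarrow> z \<in> D i" if "i < a" "z \<in> {..<a} \<times> {..<b}" for i z
    using inj_on_image_mem_iff[OF inj that(2) D[OF that(1)]] .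
  have "card (D i) = (a - 1) + (b - 1)" if "i < a" for i
    unfolding D_def using that by (subst card_Un_disjoint) (auto simp: card_cartesian_product)
  then have card: "card (g ` D i) = nseq l" if "i < a" for i
    using that ab card_image[OF inj_on_subset[OF inj D[OF that]]] by simp
  define F where "F = (\<lambda>i. g ` D i) ` {..<a}"
  have "\<exists>Q\<in>F. p \<notin> Q" for p
  proof (cases "p \<in> S")
    case True
    then obtain i j where z: "p = g (i, j)" "i < a" "j < b" using im by blast
    \<comment> \<open>A point of the first column is missed by the set of its own row. Any other
      point is missed by the set of every other row, and \<open>a2\<close> provides another
      row.\<close>
    define i' where "i' = (if j = 0 then i else if i = 0 then 1 else 0)"
    have "i' < a" using z a2 by (auto simp: i'_def)
    moreover have "(i, j) \<notin> D i'" by (auto simp: D_def i'_def)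
    ultimately have "p \<notin> g ` D i'" "g ` D i' \<in> F" using mem[of i' "(i, j)"] z by (auto simp only: F_def mem_Times_iff lessThan_iff fst_conv snd_conv)
    then show ?thesis by blast
  next
    case False
    have "g ` D 0 \<subseteq> S" using D[of 0] a2 im by (metis image_mono less_le_trans zero_less_numeral)
    moreover have "g ` D 0 \<in> F" unfolding F_def using a2 by (intro imageI) simp
    ultimately show ?thesis using False by blast
  qed
  moreover have "\<exists>q\<in>S. \<forall>Q\<in>F. p \<in> Q \<or> q \<in> Q" if p: "p \<in> S" for p
  proof -
    obtain i j where z: "p = g (i, j)" "i < a" "j < b" using im p by blast
    \<comment> \<open>For \<open>j > 0\<close>, \<open>(i, j)\<close> lies in \<open>D i\<close> and
      \<open>(i, 0)\<close> in all the other sets, so these two are partners, and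
      \<open>(i, 0)\<close> is paired with \<open>(i, 1)\<close>. If there is only one column, the
      two points of the grid are partners of each other.\<close>
    define z' where "z' = (if j > 0 then (i, 0) else if b > 1 then (i, 1) else if i = 0 then (1, 0) else (0::nat, 0::nat))"
    have z': "z' \<in> {..<a} \<times> {..<b}" using z a2 by (auto simp: z'_def)
    have "(i, j) \<in> D i' \<or> z' \<in> D i'" if "i' < a" for i'
      using z a2 a_eq b1 that by (auto simp: z'_def D_def)
    then have "\<forall>Q\<in>F. p \<in> Q \<or> g z' \<in> Q"
      using mem[OF _ z'] mem[of _ "(i, j)"] z unfolding F_def by fastforce
    moreover have "g z' \<in> S" using z' im by blast
    ultimately show ?thesis by blast
  qed
  moreover have "finite F" "card F \<le> a" 
    using card_image_le[of "{..<a}" "\<lambda>i. g ` D i"] by (auto simp: F_def)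
  moreover have "\<forall>Q\<in>F. Q \<subseteq> S \<and> card Q = nseq l"
    using card D im by (fastforce simp: F_def)
  ultimately show ?thesis unfolding a_def by blast
qed

section \<open>Gadgets and their recursive construction\<close>

definition online_trace :: "nat \<Rightarrow> nat \<Rightarrow> (nat list \<Rightarrow> config) \<Rightarrow> bool" where
  "online_trace k N g \<longleftrightarrow>
    (\<forall>h x. set h \<subseteq> {..<N} \<and> x < N \<longrightarrow> serves k (g (h @ [x])) x)"

abbreviation geom_weight :: "nat \<Rightarrow> nat \<Rightarrow> real" where
  "geom_weight \<beta> i \<equiv> real \<beta> ^ i"

abbreviation capped_weight :: "nat \<Rightarrow> nat \<Rightarrow> nat \<Rightarrow> real" where
  "capped_weight \<beta> l i \<equiv> real \<beta> ^ min i l"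

text \<open>Online, moving one of the servers \<open>l, l + 1, \<dots>\<close> only counts as \<open>\<beta> ^ l\<close>: the excess is what
  pays for escaping from a gadget of level \<open>l + 1\<close> altogether.\<close>
definition gadget :: "nat \<Rightarrow> nat \<Rightarrow> nat \<Rightarrow> nat \<Rightarrow> real \<Rightarrow> nat set \<Rightarrow> nat list pmf \<Rightarrow> bool" where
  "gadget k N \<beta> l C S R \<longleftrightarrow>
    finite (set_pmf R) \<and> (\<forall>s\<in>set_pmf R. set s \<subseteq> S) \<and>
    (\<forall>g h. online_trace k N g \<and> set h \<subseteq> {..<N} \<and> (\<forall>i. l \<le> i \<and> i < k \<longrightarrow> g h i \<notin> S) \<longrightarrow>
      real \<beta> ^ l * (1 - 1 / \<beta>) \<le> measure_pmf.expectation R (path_cost k (capped_weight \<beta> l) g h)) \<and>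
    (\<forall>c i s. valid_config k N c \<and> l \<le> i \<and> i < k \<and> c i \<in> S \<and> s \<in> set_pmf R \<longrightarrow>
      (\<exists>x c'. offline k N (geom_weight \<beta>) c s x c' \<and> x \<le> C * real \<beta> ^ l / \<beta> \<and>
        valid_config k N c' \<and> (\<forall>j. l \<le> j \<and> j < k \<longrightarrow> c' j = c j)))"

lemma gadget_online:
  assumes "gadget k N \<beta> l C S R" "online_trace k N g" "set h \<subseteq> {..<N}"
    "\<And>i. l \<le> i \<Longrightarrow> i < k \<Longrightarrow> g h i \<notin> S"
  shows "real \<beta> ^ l * (1 - 1 / \<beta>) \<le> measure_pmf.expectation R (path_cost k (capped_weight \<beta> l) g h)"
  using assms unfolding gadget_def by blast

lemma gadget_offline:
  assumes "gadget k N \<beta> l C S R" "valid_config k N c" "l \<le> i" "i < k" "c i \<in> S" "s \<in> set_pmf R"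
  obtains x c' where "offline k N (geom_weight \<beta>) c s x c'" "x \<le> C * real \<beta> ^ l / \<beta>"
    "valid_config k N c'" "\<And>j. l \<le> j \<Longrightarrow> j < k \<Longrightarrow> c' j = c j"
proof -
  have "\<exists>x c'. offline k N (geom_weight \<beta>) c s x c' \<and> x \<le> C * real \<beta> ^ l / \<beta> \<and>
      valid_config k N c' \<and> (\<forall>j. l \<le> j \<and> j < k \<longrightarrow> c' j = c j)"
    using assms unfolding gadget_def by blast
  then show ?thesis using that by blast
qed

text \<open>In units of \<open>\<beta> ^ l\<close>, level \<open>l + 1\<close> costs 1 for
  relocating server \<open>l\<close>, plus \<open>width l * \<beta>\<close> subgadgets at
  \<open>offline_const l / \<beta>\<close> each. The constants do not depend on
  \<open>\<beta>\<close>, so a large \<open>\<beta>\<close> makes the offline cost of a gadget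
  negligible against its online cost.\<close>

fun offline_const :: "nat \<Rightarrow> real" where
  "offline_const 0 = 0"
| "offline_const (Suc l) = 1 + width l * offline_const l"

text \<open>If no server is at \<open>p\<close>, one has to come, and at cap level 0 every move
  counts as 1. If some server is already there, serving is free.\<close>

lemma gadget_singleton:
  assumes "\<beta> \<ge> 1" "p < N"
  shows "gadget k N \<beta> 0 0 {p} (return_pmf [p])"
proof -
  have "real \<beta> ^ 0 * (1 - 1 / \<beta>) \<le>
      measure_pmf.expectation (return_pmf [p]) (path_cost k (capped_weight \<beta> 0) g h)"
    if g: "online_trace k N g" "set h \<subseteq> {..<N}" "\<forall>i. 0 \<le> i \<and> i < k \<longrightarrow> g h i \<notin> {p}" for g h
  proof -
    have "serves k (g (h @ [p])) p" using g assms by (auto simp: online_trace_def)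
    then obtain i where i: "i < k" "g (h @ [p]) i = p" by (auto simp: serves_def)
    have "capped_weight \<beta> 0 i \<le> move_cost k (capped_weight \<beta> 0) (g h) (g (h @ [p]))"
      using g i by (intro move_cost_ge_weight) auto
    moreover have "1 - 1 / real \<beta> \<le> 1" by simp
    ultimately have "1 - 1 / real \<beta> \<le> move_cost k (capped_weight \<beta> 0) (g h) (g (h @ [p]))"
      by (metis min_0R order_trans power_0)
    then show ?thesis by simp
  qed
  moreover have "\<exists>x c'. offline k N (geom_weight \<beta>) c s x c' \<and> x \<le> 0 * real \<beta> ^ 0 / \<beta> \<and>
      valid_config k N c' \<and> (\<forall>j. 0 \<le> j \<and> j < k \<longrightarrow> c' j = c j)"
    if c: "valid_config k N c" "i < k" "c i \<in> {p}" "s \<in> set_pmf (return_pmf [p])" for c i s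
  proof -
    have "serves k c p" using c by (auto simp: serves_def)
    then have "offline k N (geom_weight \<beta>) c s 0 c"
      using c by (auto intro: offline.intros)
    then show ?thesis using c by (intro exI[of _ 0] exI[of _ c]) auto
  qed
  ultimately show ?thesis unfolding gadget_def by (auto simp del: mult_zero_left power_0)
qed

text \<open>While the servers above \<open>l\<close> stay outside \<open>S\<close>, each block falls
  with probability at least \<open>1 / width l\<close> on a set that also misses server
  \<open>l\<close>. So \<open>width l * \<beta>\<close> blocks raise the online bound by the factor
  \<open>\<beta>\<close>. Offline, server \<open>l\<close> goes to the partner of a heavier server
  inside \<open>S\<close>, and every block then finds one of the two in its set.\<close>

lemma gadget_Suc:
  fixes R :: "nat set \<Rightarrow> nat list pmf" and C :: real
  assumes \<beta>: "\<beta> \<ge> 1" and l: "Suc l < k" and S: "S \<subseteq> {..<N}"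
    and F: "finite F" "card F \<le> width l" "\<And>Q. Q \<in> F \<Longrightarrow> Q \<subseteq> S"
    and miss: "\<And>p. \<exists>Q\<in>F. p \<notin> Q"
    and cover: "\<And>p. p \<in> S \<Longrightarrow> \<exists>q\<in>S. \<forall>Q\<in>F. p \<in> Q \<or> q \<in> Q"
    and R: "\<And>Q. Q \<in> F \<Longrightarrow> gadget k N \<beta> l C Q (R Q)"
  shows "gadget k N \<beta> (Suc l) (1 + width l * C) S
    (map_pmf concat (replicate_pmf (width l * \<beta>) (bind_pmf (pmf_of_set F) R)))"
proof -
  define B where "B = bind_pmf (pmf_of_set F) R"
  define m where "m = width l * \<beta>"
  have ne: "F \<noteq> {}" using miss by blast
  have setB: "set_pmf B = (\<Union>Q\<in>F. set_pmf (R Q))"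
    using F ne by (simp add: B_def)
  have finR: "finite (set_pmf (R Q))" if "Q \<in> F" for Q using R[OF that] by (simp add: gadget_def)
  have finB: "finite (set_pmf B)" using finR F by (simp add: setB)
  have B_sub: "set s \<subseteq> S" if "s \<in> set_pmf B" for s
    using that R F(3) unfolding setB gadget_def by fastforce
  have "finite (set_pmf (map_pmf concat (replicate_pmf m B)))"
    using finite_set_replicate_pmf[OF finB] by simp
  moreover have "set s \<subseteq> S" if "s \<in> set_pmf (map_pmf concat (replicate_pmf m B))" for s
    using that B_sub set_replicate_pmfD by fastforce
  moreover have "real \<beta> ^ Suc l * (1 - 1 / \<beta>) \<le>
      measure_pmf.expectation (map_pmf concat (replicate_pmf m B)) (path_cost k (capped_weight \<beta> (Suc l)) g h)"
    if g: "online_trace k N g" and h: "set h \<subseteq> {..<N}" "\<forall>i. Suc l \<le> i \<and> i < k \<longrightarrow> g h i \<notin> S" for g h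
  proof -
    define G where "G h \<longleftrightarrow> set h \<subseteq> {..<N} \<and> (\<forall>i. Suc l \<le> i \<and> i < k \<longrightarrow> g h i \<notin> S)" for h
    define \<delta> where "\<delta> = real \<beta> ^ l * (1 - 1 / \<beta>) / width l"
    \<comment> \<open>The surcharge for a server above \<open>l\<close> when the cap rises from
      level \<open>l\<close> to \<open>l + 1\<close>. By \<open>mD\<close> it equals the bound
      wanted for all \<open>m\<close> blocks together, so entering \<open>S\<close> never pays
      off.\<close>
    define D where "D = real \<beta> ^ Suc l - real \<beta> ^ l"
    have \<delta>0: "0 \<le> \<delta>" using \<beta> by (simp add: \<delta>_def)
    have m\<delta>: "real m * \<delta> = real \<beta> ^ Suc l * (1 - 1 / \<beta>)"
      using width_pos[of l] by (simp add: m_def \<delta>_def)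
    have mD: "real m * \<delta> = D" unfolding m\<delta> D_def using \<beta> by (simp add: field_simps)
    have "real m * \<delta> \<le> measure_pmf.expectation (replicate_pmf m B)
        (\<lambda>xs. path_cost k (capped_weight \<beta> (Suc l)) g h (concat (map (\<lambda>s. s) xs)))"
    proof (rule expectation_path_cost_iid_blocks[where G = G and D = D and m = m
          and e = "path_cost k (capped_weight \<beta> l) g"])
      show "finite (set_pmf B)" by (rule finB)
    next
      fix h assume G: "G h"
      \<comment> \<open>All servers from \<open>l\<close> on are outside this \<open>Q\<close>, so
        its gadget is expensive. The other members of \<open>F\<close> are only known to have
        nonnegative cost, and averaging over at most \<open>width l\<close> members leaves
        \<open>\<delta>\<close>.\<close>
      obtain Q where Q: "Q \<in> F" "g h l \<notin> Q" using miss by blast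
      let ?e = "\<lambda>Q. measure_pmf.expectation (R Q) (path_cost k (capped_weight \<beta> l) g h)"
      have "g h i \<notin> Q" if "l \<le> i" "i < k" for i
        using that G Q F(3)[OF Q(1)] by (cases "i = l") (auto simp: G_def)
      then have "real \<beta> ^ l * (1 - 1 / \<beta>) \<le> ?e Q"
        using R[OF Q(1)] g G unfolding gadget_def G_def by blast
      also have "?e Q \<le> sum ?e F"
        using Q F by (intro member_le_sum) (auto intro!: Bochner_Integration.integral_nonneg path_cost_nonneg)
      finally have sum: "real \<beta> ^ l * (1 - 1 / \<beta>) \<le> sum ?e F" .
      have "\<delta> \<le> sum ?e F / card F"
        unfolding \<delta>_def
      proof (rule frac_le)
        show "0 \<le> sum ?e F"
          by (intro sum_nonneg Bochner_Integration.integral_nonneg path_cost_nonneg) auto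
      qed (use sum F ne in \<open>auto simp: card_gt_0_iff\<close>)
      also have "\<dots> = measure_pmf.expectation B (path_cost k (capped_weight \<beta> l) g h)"
        unfolding B_def using F ne finR 
        by (subst expectation_bind_pmf) (simp_all add: integral_pmf_of_set)
      finally show "\<delta> \<le> measure_pmf.expectation B (\<lambda>s. path_cost k (capped_weight \<beta> l) g h s)" .
    next
      fix h s
      show "path_cost k (capped_weight \<beta> l) g h s \<le> path_cost k (capped_weight \<beta> (Suc l)) g h s"
        using \<beta> by (intro path_cost_mono power_increasing) auto
    next
      fix h s assume G: "G h" and s: "s \<in> set_pmf B" and nG: "\<not> G (h @ s)"
      have "set (h @ s) \<subseteq> {..<N}" using G B_sub[OF s] S by (auto simp: G_def)
      then obtain i where "Suc l \<le> i" "i < k" "g h i \<notin> S" "g (h @ s) i \<in> S"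
        using G nG unfolding G_def by blast
      then have i: "Suc l \<le> i" "i < k" "g h i \<noteq> g (h @ s) i" by auto
      \<comment> \<open>The entering server \<open>i\<close> has moved during the block. Under the
        difference of the two capped weights its move alone is worth \<open>D\<close>.\<close>
      have "real \<beta> ^ min i (Suc l) - real \<beta> ^ min i l \<le>
          path_cost k (\<lambda>i. capped_weight \<beta> (Suc l) i - capped_weight \<beta> l i) g h s"
        using \<beta> i by (intro path_cost_ge_weight) (auto intro!: power_increasing)
      then show "path_cost k (capped_weight \<beta> l) g h s + D \<le> path_cost k (capped_weight \<beta> (Suc l)) g h s"
        using i by (simp add: path_cost_diff[symmetric] D_def min_absorb2 del: power_Suc)
    next
      fix j assume "j < m"
      then have "real j * \<delta> \<le> real m * \<delta>" using \<delta>0 by (intro mult_right_mono) auto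
      then show "real j * \<delta> \<le> D" using mD by simp
    qed (use h in \<open>auto simp: G_def\<close>)
    then show ?thesis unfolding m\<delta> by simp
  qed
  moreover have "\<exists>x c'. offline k N (geom_weight \<beta>) c s x c' \<and> x \<le> (1 + width l * C) * real \<beta> ^ Suc l / \<beta> \<and>
        valid_config k N c' \<and> (\<forall>j. Suc l \<le> j \<and> j < k \<longrightarrow> c' j = c j)"
    if c: "valid_config k N c" and i: "Suc l \<le> i" "i < k" "c i \<in> S"
      and s: "s \<in> set_pmf (map_pmf concat (replicate_pmf m B))" for c i s
  proof -
    obtain q where q: "q \<in> S" "\<And>Q. Q \<in> F \<Longrightarrow> c i \<in> Q \<or> q \<in> Q" using cover[OF i(3)] by blast
    obtain ss where ss: "s = concat ss" "length ss = m" "set ss \<subseteq> set_pmf B"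
      using s set_replicate_pmfD by fastforce
    define c1 where "c1 = c(l := q)"
    have c1: "valid_config k N c1" using c q S by (auto simp: c1_def valid_config_def)
    \<comment> \<open>Generalised to any \<open>d\<close> that agrees with \<open>c1\<close> from
      server \<open>l\<close> on: earlier blocks may leave the lighter servers anywhere.\<close>
    have "\<exists>x c'. offline k N (geom_weight \<beta>) d (concat ss) x c' \<and> x \<le> length ss * (C * real \<beta> ^ l / \<beta>) \<and>
        valid_config k N c' \<and> (\<forall>j. l \<le> j \<and> j < k \<longrightarrow> c' j = c1 j)"
      if "valid_config k N d" "\<forall>j. l \<le> j \<and> j < k \<longrightarrow> d j = c1 j" "set ss \<subseteq> set_pmf B" for ss d
      using that
    proof (induction ss arbitrary: d)
      case Nil
      then show ?case using offline.stop[of k N "geom_weight \<beta>" d] by auto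
    next
      case (Cons s ss)
      obtain Q where Q: "Q \<in> F" "s \<in> set_pmf (R Q)" using Cons.prems setB by auto
      have "d l = q" "d i = c i" using Cons.prems i l by (auto simp: c1_def)
      then have "\<exists>j. l \<le> j \<and> j < k \<and> d j \<in> Q"
        using q(2)[OF Q(1)] i by (metis Suc_leD Suc_lessD l le_refl)
      then obtain x c' where x: "offline k N (geom_weight \<beta>) d s x c'" "x \<le> C * real \<beta> ^ l / \<beta>"
          "valid_config k N c'" "\<forall>j. l \<le> j \<and> j < k \<longrightarrow> c' j = d j"
        using R[OF Q(1)] Q(2) Cons.prems(1) unfolding gadget_def by blast
      obtain y c'' where y: "offline k N (geom_weight \<beta>) c' (concat ss) y c''"
          "y \<le> length ss * (C * real \<beta> ^ l / \<beta>)"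
          "valid_config k N c''" "\<forall>j. l \<le> j \<and> j < k \<longrightarrow> c'' j = c1 j"
        using Cons.IH[of c'] Cons.prems x by auto
      have "x + y \<le> length (s # ss) * (C * real \<beta> ^ l / \<beta>)"
        using x(2) y(2) by (simp add: algebra_simps add_divide_distrib)
      then show ?case using offline_append[OF x(1) y(1)] y by auto
    qed
    from this[OF c1 _ ss(3)] obtain x c' where x: "offline k N (geom_weight \<beta>) c1 s x c'"
        "x \<le> m * (C * real \<beta> ^ l / \<beta>)" "valid_config k N c'" "\<forall>j. l \<le> j \<and> j < k \<longrightarrow> c' j = c1 j"
      using ss by auto
    have "move_cost k (geom_weight \<beta>) c c1 \<le> real \<beta> ^ l"
      unfolding c1_def by (rule move_cost_fun_upd_le) simp
    then have "move_cost k (geom_weight \<beta>) c c1 + x \<le> real \<beta> ^ l + m * (C * real \<beta> ^ l / \<beta>)"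
      using x(2) by linarith
    also have "\<dots> = (1 + width l * C) * real \<beta> ^ Suc l / \<beta>"
      using \<beta> by (simp add: m_def field_simps)
    finally have "move_cost k (geom_weight \<beta>) c c1 + x \<le> (1 + width l * C) * real \<beta> ^ Suc l / \<beta>" .
    moreover have "\<forall>j. Suc l \<le> j \<and> j < k \<longrightarrow> c' j = c j"
      using x(4) by (auto simp: c1_def)
    ultimately show ?thesis using offline.move[OF c1 x(1), of c] x(3) by blast
  qed
  ultimately show ?thesis unfolding gadget_def B_def[symmetric] m_def[symmetric] by blast
qed

lemma gadget_exists:
  assumes "\<beta> \<ge> 1" "l < k" "S \<subseteq> {..<N}" "card S = nseq l"
  shows "\<exists>R. gadget k N \<beta> l (offline_const l) S R"
  using assms(2-)
proof (induction l arbitrary: S)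
  case 0
  then obtain p where "S = {p}" by (auto simp: card_1_singleton_iff)
  then show ?case using gadget_singleton[OF assms(1), of p N k] 0 by auto
next
  case (Suc l)
  have "finite S" using Suc.prems finite_subset by blast
  then obtain F where F: "finite F" "card F \<le> width l" "\<And>Q. Q \<in> F \<Longrightarrow> Q \<subseteq> S"
    "\<And>Q. Q \<in> F \<Longrightarrow> card Q = nseq l"
    "\<And>p. \<exists>Q\<in>F. p \<notin> Q" "\<And>p. p \<in> S \<Longrightarrow> \<exists>q\<in>S. \<forall>Q\<in>F. p \<in> Q \<or> q \<in> Q"
    using set_system[OF _ Suc.prems(3)] by metis
  have "\<exists>R. gadget k N \<beta> l (offline_const l) Q R" if "Q \<in> F" for Q
    using Suc.prems F(3,4)[OF that] by (intro Suc.IH) auto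
  then obtain R where "\<And>Q. Q \<in> F \<Longrightarrow> gadget k N \<beta> l (offline_const l) Q (R Q)" by metis
  from gadget_Suc[OF assms(1) Suc.prems(1,2) F(1-3) F(5,6) this]
  show ?case by auto
qed

section \<open>Coupon collector phases and the heaviest server offline\<close>

lemma singleton_psubset_lessThan:
  fixes p N :: nat
  assumes "p < N" "N \<ge> 2"
  shows "{p} \<subset> {..<N}"
proof -
  have "(if p = 0 then 1 else 0) \<in> {..<N} - {p}" using assms by auto
  then show ?thesis using assms(1) by blast
qed

text \<open>The point that completes a phase already counts for the next one, because the server has
  to move away before that block. Phases after the first thus start with one coupon collected, which
  gives \<open>harm (N - 1)\<close> instead of \<open>harm N\<close>.\<close>

fun phases :: "'a set \<Rightarrow> 'a set \<Rightarrow> 'a list \<Rightarrow> nat" where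
  "phases P M [] = 0"
| "phases P M (p # ps) =
    (if insert p M = P then Suc (phases P {p} ps) else phases P (insert p M) ps)"

text \<open>Coupon collector: the potential \<open>(harm N - harm (N - card M)) / harm n\<close>
  makes the number of completed phases a martingale up to the drift \<open>1 / (N * harm n)\<close>.\<close>
lemma expectation_phases_le:
  fixes n T :: nat
  assumes n: "n \<ge> 1" and M: "M \<subset> {..<Suc n}"
  defines "N \<equiv> Suc n"
  shows "measure_pmf.expectation (replicate_pmf T (pmf_of_set {..<N})) (\<lambda>ps. real (phases {..<N} M ps))
    \<le> T / (N * harm n) + (harm N - harm (N - card M)) / harm n"
  using M unfolding N_def[symmetric]
proof (induction T arbitrary: M)
  case 0
  have "harm (N - card M) \<le> (harm N :: real)" by (intro harm_mono) simp
  then show ?case by (simp add: harm_nonneg)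
next
  case (Suc T)
  let ?E = "\<lambda>M. measure_pmf.expectation (replicate_pmf T (pmf_of_set {..<N})) (\<lambda>ps. real (phases {..<N} M ps))"
  define \<psi> where "\<psi> M = (harm N - harm (N - card M)) / (harm n :: real)" for M :: "nat set"
  \<comment> \<open>The gain in potential from one new point. A new point comes with probability
    \<open>(N - card M) / N\<close>, so the expected gain is \<open>1 / (N * harm n)\<close>
    whatever \<open>M\<close> is.\<close>
  define d where "d = 1 / (real (N - card M) * harm n)"
  have hn: "harm n > (0::real)" using n by (intro harm_pos) simp
  then have hn0: "harm n \<noteq> (0::real)" by linarith
  have finM: "finite M" and cM: "card M < N"
    using Suc.prems finite_subset psubset_card_mono[of "{..<N}" M] by (blast, simp)
  have N: "N > 0" by (simp add: N_def)
  have fin: "finite (set_pmf (pmf_of_set {..<N}))" using N by (subst set_pmf_of_set) auto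
  have fin': "finite (set_pmf (replicate_pmf T (pmf_of_set {..<N})))"
    by (rule finite_set_replicate_pmf[OF fin])
  have IH: "?E M' \<le> T / (N * harm n) + \<psi> M'" if "M' \<subset> {..<N}" for M'
    using Suc.IH[OF that] by (simp add: \<psi>_def)
  have step: "(if insert p M = {..<N} then 1 + ?E {p} else ?E (insert p M))
      \<le> T / (N * harm n) + \<psi> M + (if p \<in> M then 0 else d)" if p: "p < N" for p
  proof (cases "p \<in> M")
    case True
    then have "insert p M = M" by blast
    then show ?thesis using IH[of M] Suc.prems True by auto
  next
    case False
    then have card: "card (insert p M) = Suc (card M)" using finM by simp
    show ?thesis
    proof (cases "insert p M = {..<N}")
      case True
      then have m: "card M = n" using card by (simp add: N_def)
      have "{p} \<subset> {..<N}" using p n by (intro singleton_psubset_lessThan) (simp_all add: N_def)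
      then have "?E {p} \<le> T / (N * harm n) + \<psi> {p}" by (rule IH)
      \<comment> \<open>Both sides equal \<open>harm N / harm n\<close>: dividing by
        \<open>harm n\<close> makes the reset of the potential worth exactly one phase.\<close>
      moreover have "1 + \<psi> {p} = \<psi> M + d"
        using hn0 by (simp add: \<psi>_def d_def m N_def harm_Suc harm_expand(1) add_divide_distrib diff_divide_distrib)
      ultimately show ?thesis using True False by simp
    next
      case neq: False
      then have sub: "insert p M \<subset> {..<N}" using Suc.prems p by blast
      then have "Suc (card M) < N" using psubset_card_mono[of "{..<N}" "insert p M"] card by simp
      then obtain r where r: "N - card M = Suc r" "N - Suc (card M) = r" 
        by (metis Suc_diff_Suc Suc_lessD)
      have "\<psi> (insert p M) = \<psi> M + d"
        using hn0 unfolding \<psi>_def d_def card r harm_Suc by (simp add: add_divide_distrib diff_divide_distrib inverse_eq_divide)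
      then show ?thesis using IH[OF sub] neq False by simp
    qed
  qed
  have "measure_pmf.expectation (replicate_pmf (Suc T) (pmf_of_set {..<N})) (\<lambda>ps. real (phases {..<N} M ps))
     = measure_pmf.expectation (pmf_of_set {..<N})
         (\<lambda>p. if insert p M = {..<N} then 1 + ?E {p} else ?E (insert p M))"
    unfolding expectation_replicate_pmf_Suc[OF fin]
    by (intro Bochner_Integration.integral_cong) (auto simp: integrable_measure_pmf_finite[OF fin'])
  also have "\<dots> \<le> measure_pmf.expectation (pmf_of_set {..<N})
      (\<lambda>p. T / (N * harm n) + \<psi> M + (if p \<in> M then 0 else d))"
    using step N by (intro expectation_mono_pmf[OF fin]) (auto simp: lessThan_empty_iff)
  also have "\<dots> = T / (N * harm n) + \<psi> M + (\<Sum>p<N. if p \<in> M then 0 else d) / N"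
    using N by (subst integral_pmf_of_set) (auto simp: sum.distrib field_simps lessThan_empty_iff)
  also have "(\<Sum>p<N. if p \<in> M then 0 else d) = (\<Sum>p\<in>{..<N} - M. d)"
    by (intro sum.mono_neutral_cong_right) auto
  also have "\<dots> = 1 / harm n"
    using Suc.prems finM cM by (simp add: d_def card_Diff_subset)
  finally show ?case using hn0 N by (simp add: \<psi>_def add_divide_distrib mult.commute)
qed

text \<open>Knowing the future, the heaviest server can wait at a point \<open>y\<close> that is not
  excluded before the current phase is completed. It is then inside the set of every block of that
  phase and moves only when a phase ends. Quantifying over \<open>c\<close> after \<open>y\<close>
  leaves the other servers free.\<close>

lemma offline_phases:
  fixes C :: real
  assumes k: "k \<ge> 1" and N: "N \<ge> 2"
    and R: "\<And>p. p < N \<Longrightarrow> gadget k N \<beta> (k - 1) C ({..<N} - {p}) (R p)"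
    and ps: "\<And>p s. (p, s) \<in> set ps \<Longrightarrow> p < N \<and> s \<in> set_pmf (R p)"
    and M: "M \<subset> {..<N}"
  shows "\<exists>y\<in>{..<N} - M. \<forall>c. valid_config k N c \<and> c (k - 1) = y \<longrightarrow>
    (\<exists>x c'. offline k N (geom_weight \<beta>) c (concat (map snd ps)) x c' \<and>
      x \<le> real \<beta> ^ (k - 1) * phases {..<N} M (map fst ps) + length ps * (C * real \<beta> ^ (k - 1) / \<beta>))"
  using ps M
proof (induction ps arbitrary: M)
  case Nil
  then obtain y where "y \<in> {..<N} - M" by blast
  moreover have "offline k N (geom_weight \<beta>) c [] 0 c" for c by (rule offline.stop)
  ultimately show ?case by fastforce
next
  case (Cons b ps)
  obtain p s where b: "b = (p, s)" by (cases b)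
  have kk: "k - 1 < k" using k by simp
  have p: "p < N" "s \<in> set_pmf (R p)" using Cons.prems(1)[of p s] b by auto
  let ?X = "\<lambda>M. real \<beta> ^ (k - 1) * phases {..<N} M (map fst ps) + length ps * (C * real \<beta> ^ (k - 1) / \<beta>)"
  \<comment> \<open>Common to both cases: a \<open>y\<close> outside a set containing
    \<open>p\<close> differs from \<open>p\<close>, so the heaviest server is inside the set of the
    present block.\<close>
  have block: "\<exists>y\<in>{..<N} - M'. \<forall>c. valid_config k N c \<and> c (k - 1) = y \<longrightarrow>
    (\<exists>x c'. offline k N (geom_weight \<beta>) c (s @ concat (map snd ps)) x c' \<and>
      x \<le> C * real \<beta> ^ (k - 1) / \<beta> + ?X M')" if M': "M' \<subset> {..<N}" "p \<in> M'" for M'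
  proof -
    obtain y where y: "y \<in> {..<N} - M'" and IH: "\<And>c. valid_config k N c \<Longrightarrow> c (k - 1) = y \<Longrightarrow>
      (\<exists>x c'. offline k N (geom_weight \<beta>) c (concat (map snd ps)) x c' \<and> x \<le> ?X M')"
      using Cons.IH[OF _ M'(1)] Cons.prems(1) by (metis list.set_intros(2))
    have "\<exists>x c'. offline k N (geom_weight \<beta>) c (s @ concat (map snd ps)) x c' \<and>
      x \<le> C * real \<beta> ^ (k - 1) / \<beta> + ?X M'" if c: "valid_config k N c" "c (k - 1) = y" for c
    proof -
      have "c (k - 1) \<in> {..<N} - {p}" using c y M' by auto
      then obtain x c' where x: "offline k N (geom_weight \<beta>) c s x c'" "x \<le> C * real \<beta> ^ (k - 1) / \<beta>"
          "valid_config k N c'" "\<And>j. k - 1 \<le> j \<Longrightarrow> j < k \<Longrightarrow> c' j = c j"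
        using gadget_offline[OF R[OF p(1)] c(1) le_refl kk _ p(2)] by blast
      then have c': "c' (k - 1) = y" using c kk by simp
      obtain x' c'' where x': "offline k N (geom_weight \<beta>) c' (concat (map snd ps)) x' c''" "x' \<le> ?X M'"
        using IH[OF x(3) c'] by blast
      show ?thesis using offline_append[OF x(1) x'(1)] x(2) x'(2) by (meson add_mono)
    qed
    then show ?thesis using y by blast
  qed
  show ?case
  proof (cases "insert p M = {..<N}")
    case True
    obtain y where y: "y \<in> {..<N} - {p}" and blk: "\<And>c. valid_config k N c \<Longrightarrow> c (k - 1) = y \<Longrightarrow>
      \<exists>x c'. offline k N (geom_weight \<beta>) c (s @ concat (map snd ps)) x c' \<and>
        x \<le> C * real \<beta> ^ (k - 1) / \<beta> + ?X {p}"
      using block[OF singleton_psubset_lessThan[OF p(1) N]] by blast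
    have "\<exists>x c'. offline k N (geom_weight \<beta>) c (s @ concat (map snd ps)) x c' \<and>
        x \<le> real \<beta> ^ (k - 1) + (C * real \<beta> ^ (k - 1) / \<beta> + ?X {p})" if c: "valid_config k N c" for c
    proof -
      define c1 where "c1 = c(k - 1 := y)"
      have c1: "valid_config k N c1" "c1 (k - 1) = y" using c y by (auto simp: c1_def valid_config_def)
      obtain x c' where x: "offline k N (geom_weight \<beta>) c1 (s @ concat (map snd ps)) x c'"
          "x \<le> C * real \<beta> ^ (k - 1) / \<beta> + ?X {p}" using blk[OF c1] by blast
      have "move_cost k (geom_weight \<beta>) c c1 \<le> real \<beta> ^ (k - 1)"
        unfolding c1_def by (rule move_cost_fun_upd_le) simp
      then show ?thesis using offline.move[OF c1(1) x(1), of c] x(2) by (meson add_mono)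
    qed
    \<comment> \<open>The only possible witness is \<open>p\<close> itself. It does no harm, since
      the heaviest server leaves for \<open>y\<close> before the block is served.\<close>
    moreover have "p \<in> {..<N} - M" using True Cons.prems(2) p by auto
    moreover have "real \<beta> ^ (k - 1) * phases {..<N} M (map fst (b # ps)) + length (b # ps) * (C * real \<beta> ^ (k - 1) / \<beta>) =
        real \<beta> ^ (k - 1) + (C * real \<beta> ^ (k - 1) / \<beta> + ?X {p})"
      using True by (simp add: b distrib_right distrib_left add_divide_distrib)
    moreover have "concat (map snd (b # ps)) = s @ concat (map snd ps)" by (simp add: b)
    ultimately show ?thesis by metis
  next
    case False
    then have "insert p M \<subset> {..<N}" using Cons.prems(2) p by auto
    from block[OF this] obtain y where "y \<in> {..<N} - M" and "\<And>c. valid_config k N c \<Longrightarrow> c (k - 1) = y \<Longrightarrow>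
      \<exists>x c'. offline k N (geom_weight \<beta>) c (s @ concat (map snd ps)) x c' \<and>
        x \<le> C * real \<beta> ^ (k - 1) / \<beta> + ?X (insert p M)" by blast
    moreover have "real \<beta> ^ (k - 1) * phases {..<N} M (map fst (b # ps)) + length (b # ps) * (C * real \<beta> ^ (k - 1) / \<beta>) =
        C * real \<beta> ^ (k - 1) / \<beta> + ?X (insert p M)"
      using False by (simp add: b distrib_right distrib_left add_divide_distrib)
    moreover have "concat (map snd (b # ps)) = s @ concat (map snd ps)" by (simp add: b)
    ultimately show ?thesis by metis
  qed
qed

section \<open>Yao's principle and the hard distribution\<close>

lemma map_replicate_pmf: "map_pmf (map f) (replicate_pmf n p) = replicate_pmf n (map_pmf f p)"
proof (induction n)
  case (Suc n)
  have "map_pmf (map f) (replicate_pmf (Suc n) p) =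
      bind_pmf p (\<lambda>x. bind_pmf (map_pmf (map f) (replicate_pmf n p)) (\<lambda>xs. return_pmf (f x # xs)))"
    by (simp add: map_bind_pmf bind_map_pmf)
  then show ?case by (simp add: Suc bind_map_pmf)
qed simp

lemma integrable_alg_cost:
  assumes "rand_alg k N M"
  shows "integrable M (\<lambda>A. alg_cost k w A c0 \<sigma>)"
proof -
  interpret prob_space M using assms by (simp add: rand_alg_def)
  have [measurable]: "(\<lambda>A. A c xs i) \<in> measurable M (count_space UNIV)" for c xs i
    using assms by (simp add: rand_alg_def)
  have "integrable M (\<lambda>A. if A c0 xs i \<noteq> A c0 ys i then w i else 0)" for xs ys i
    by (rule integrable_const_bound[of _ "\<bar>w i\<bar>"]) (auto, measurable)
  then show ?thesis unfolding alg_cost_def move_cost_def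
    by (intro Bochner_Integration.integrable_sum)
qed

text \<open>The easy direction of Yao's principle: average the deterministic bound over
  \<open>M\<close>, exchange the integral with the finite sum over the support of \<open>p\<close>,
  and apply competitiveness to each sequence.\<close>

lemma competitive_expected_cost:
  assumes M: "rand_alg k N M" and comp: "competitive k N w M \<alpha>"
    and p: "finite (set_pmf p)" "\<And>\<sigma>. \<sigma> \<in> set_pmf p \<Longrightarrow> set \<sigma> \<subseteq> {..<N}"
    and c0: "valid_config k N c0"
    and L: "\<And>A. online_alg k N A \<Longrightarrow> L \<le> measure_pmf.expectation p (alg_cost k w A c0)"
  shows "L \<le> \<alpha> * measure_pmf.expectation p (opt_cost k N w c0)"
proof -
  interpret prob_space M using M by (simp add: rand_alg_def)
  have E: "measure_pmf.expectation p f = (\<Sum>\<sigma>\<in>set_pmf p. pmf p \<sigma> * f \<sigma>)" for f :: "nat list \<Rightarrow> real"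
    using p by (subst integral_measure_pmf[of "set_pmf p"]) auto
  note int = integrable_alg_cost[OF M]
  have "L = (\<integral>A. L \<partial>M)" by (simp add: prob_space)
  also have "\<dots> \<le> (\<integral>A. measure_pmf.expectation p (alg_cost k w A c0) \<partial>M)"
  proof (rule integral_mono)
    show "integrable M (\<lambda>A. measure_pmf.expectation p (alg_cost k w A c0))"
      unfolding E using int by simp
  qed (use L M in \<open>auto simp: rand_alg_def\<close>)
  also have "\<dots> = (\<Sum>\<sigma>\<in>set_pmf p. pmf p \<sigma> * (\<integral>A. alg_cost k w A c0 \<sigma> \<partial>M))"
    unfolding E using int by (simp add: Bochner_Integration.integral_sum)
  also have "\<dots> \<le> (\<Sum>\<sigma>\<in>set_pmf p. pmf p \<sigma> * (\<alpha> * opt_cost k N w c0 \<sigma>))"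
    using comp p c0 unfolding competitive_def by (intro sum_mono mult_left_mono) auto
  also have "\<dots> = \<alpha> * measure_pmf.expectation p (opt_cost k N w c0)"
    unfolding E by (simp add: sum_distrib_left algebra_simps)
  finally show ?thesis .
qed

lemma hard_distribution:
  fixes T :: nat
  assumes k: "k \<ge> 1" and \<beta>: "\<beta> \<ge> 1"
  defines "n \<equiv> nseq (k - 1)"
  defines "N \<equiv> n + 1"
  shows "\<exists>p. finite (set_pmf p) \<and> (\<forall>\<sigma>\<in>set_pmf p. set \<sigma> \<subseteq> {..<N}) \<and>
    (\<forall>A. online_alg k N A \<longrightarrow> real T * (real \<beta> ^ (k - 1) * (1 - 1 / \<beta>) / N) \<le>
      measure_pmf.expectation p (alg_cost k (geom_weight \<beta>) A (\<lambda>_. 0))) \<and>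
    (\<forall>\<sigma>\<in>set_pmf p. 0 \<le> opt_cost k N (geom_weight \<beta>) (\<lambda>_. 0) \<sigma>) \<and>
    measure_pmf.expectation p (opt_cost k N (geom_weight \<beta>) (\<lambda>_. 0)) \<le>
      real \<beta> ^ (k - 1) * (1 + T / (N * harm n)) + T * (offline_const (k - 1) * real \<beta> ^ (k - 1) / \<beta>)"
proof -
  let ?C = "offline_const (k - 1)" and ?c0 = "\<lambda>_::nat. 0::nat"
  have n1: "n \<ge> 1" unfolding n_def by (rule nseq_pos)
  then have N2: "N \<ge> 2" by (simp add: N_def)
  then have N_ne: "{} \<subset> {..<N}" by (auto simp: psubset_eq lessThan_empty_iff dest: sym)
  have "\<exists>R. gadget k N \<beta> (k - 1) ?C ({..<N} - {p}) R" if "p < N" for p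
    using that k \<beta> by (intro gadget_exists) (auto simp: N_def n_def)
  then obtain R where R: "\<And>p. p < N \<Longrightarrow> gadget k N \<beta> (k - 1) ?C ({..<N} - {p}) (R p)" by metis
  define U where "U = pmf_of_set {..<N}"
  have setU: "set_pmf U = {..<N}" unfolding U_def using N2 by (subst set_pmf_of_set) (auto simp: lessThan_empty_iff)
  have finU: "finite (set_pmf U)" by (simp add: setU)
  \<comment> \<open>The excluded point is kept next to the requests: the phases of the offline
    strategy are read off the points, the online cost off the requests alone.\<close>
  define B where "B = bind_pmf U (\<lambda>p. map_pmf (Pair p) (R p))"
  have setB: "set_pmf B = Sigma {..<N} (\<lambda>p. set_pmf (R p))"
    by (auto simp: B_def setU)
  have finR: "finite (set_pmf (R p))" if "p < N" for p using R[OF that] by (simp add: gadget_def)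
  have finB: "finite (set_pmf B)" unfolding setB using finR by (intro finite_SigmaI) auto
  have fstB: "map_pmf fst B = U" by (simp add: B_def map_bind_pmf map_pmf_comp map_pmf_const bind_return_pmf')
  have subB: "set (snd b) \<subseteq> {..<N}" if "b \<in> set_pmf B" for b
    using that R unfolding setB gadget_def by fastforce
  define p where "p = map_pmf (\<lambda>bs. concat (map snd bs)) (replicate_pmf T B)"
  have finBT: "finite (set_pmf (replicate_pmf T B))" by (rule finite_set_replicate_pmf[OF finB])
  have "finite (set_pmf p)" using finBT by (simp add: p_def)
  moreover have "set \<sigma> \<subseteq> {..<N}" if "\<sigma> \<in> set_pmf p" for \<sigma>
    using that subB set_replicate_pmfD(2) unfolding p_def by fastforce
  moreover have "real T * (real \<beta> ^ (k - 1) * (1 - 1 / \<beta>) / N) \<le>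
      measure_pmf.expectation p (alg_cost k (geom_weight \<beta>) A ?c0)" if A: "online_alg k N A" for A
  proof -
    let ?g = "A ?c0"
    have g: "online_trace k N ?g"
      unfolding online_trace_def
    proof (intro allI impI)
      fix h x assume "set h \<subseteq> {..<N} \<and> x < N"
      moreover have "valid_config k N ?c0" using N2 by (simp add: valid_config_def)
      ultimately have "serves k (?g (h @ [x])) (last (h @ [x]))"
        using A unfolding online_alg_def
        by (metis (no_types, lifting) append_is_Nil_conv empty_set insert_subset le_sup_iff
            lessThan_iff list.simps(15) not_Cons_self2 set_append empty_subsetI)
      then show "serves k (?g (h @ [x])) x" by simp
    qed
    define \<delta> where "\<delta> = real \<beta> ^ (k - 1) * (1 - 1 / \<beta>) / N"
    have \<delta>0: "\<delta> \<ge> 0" using \<beta> by (simp add: \<delta>_def)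
    \<comment> \<open>Here \<open>G\<close> only says that the history lies in the space, so it is
      never left and the surcharge \<open>T * \<delta>\<close> is never claimed.\<close>
    have "real T * \<delta> \<le> measure_pmf.expectation (replicate_pmf T B)
        (\<lambda>bs. path_cost k (geom_weight \<beta>) ?g [] (concat (map snd bs)))"
    proof (rule expectation_path_cost_iid_blocks[where G = "\<lambda>h. set h \<subseteq> {..<N}"
          and D = "T * \<delta>" and m = T and e = "path_cost k (capped_weight \<beta> (k - 1)) ?g"])
      fix h assume h: "set h \<subseteq> {..<N}"
      \<comment> \<open>Only server \<open>k - 1\<close> matters at the top level, and excluding its
        position makes the block expensive. A value that is not a point of the space is outside
        every block's set, so then any \<open>q\<close> would do.\<close>
      define q where "q = (if ?g h (k - 1) < N then ?g h (k - 1) else 0)"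
      have q: "q < N" using N2 by (simp add: q_def)
      let ?e = "\<lambda>p. measure_pmf.expectation (R p) (path_cost k (capped_weight \<beta> (k - 1)) ?g h)"
      have "?g h i \<notin> {..<N} - {q}" if "k - 1 \<le> i" "i < k" for i
      proof -
        have "i = k - 1" using that by simp
        then show ?thesis by (auto simp: q_def)
      qed
      then have "real \<beta> ^ (k - 1) * (1 - 1 / \<beta>) \<le> ?e q"
        using gadget_online[OF R[OF q] g h] by blast
      also have "?e q \<le> sum ?e {..<N}"
        using q by (intro member_le_sum) (auto intro!: Bochner_Integration.integral_nonneg path_cost_nonneg)
      finally have "\<delta> \<le> sum ?e {..<N} / card {..<N}"
        unfolding \<delta>_def by (simp add: divide_right_mono)
      also have "\<dots> = measure_pmf.expectation B (\<lambda>b. path_cost k (capped_weight \<beta> (k - 1)) ?g h (snd b))"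
        unfolding B_def using finR N2 finU setU
        by (subst expectation_bind_pmf) (simp_all add: U_def integral_pmf_of_set lessThan_empty_iff)
      finally show "\<delta> \<le> measure_pmf.expectation B (\<lambda>b. path_cost k (capped_weight \<beta> (k - 1)) ?g h (snd b))" .
    next
      fix h b
      show "path_cost k (capped_weight \<beta> (k - 1)) ?g h (snd b) \<le> path_cost k (geom_weight \<beta>) ?g h (snd b)"
        using \<beta> by (intro path_cost_mono power_increasing) auto
    next
      fix j assume "j < T"
      then show "real j * \<delta> \<le> T * \<delta>" using \<delta>0 by (intro mult_right_mono) auto
    qed (use finB subB in auto)
    then show ?thesis by (simp add: p_def alg_cost_eq_path_cost \<delta>_def)
  qed
  moreover have off: "\<exists>x c'. offline k N (geom_weight \<beta>) ?c0 (concat (map snd bs)) x c' \<and>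
      x \<le> real \<beta> ^ (k - 1) * (1 + phases {..<N} {} (map fst bs)) + T * (?C * real \<beta> ^ (k - 1) / \<beta>)"
    if bs: "bs \<in> set_pmf (replicate_pmf T B)" for bs
  proof -
    have "p < N \<and> s \<in> set_pmf (R p)" if "(p, s) \<in> set bs" for p s
      using set_replicate_pmfD(2)[OF bs] that setB by auto
    then obtain y where y: "y < N" and off: "\<And>c. valid_config k N c \<Longrightarrow> c (k - 1) = y \<Longrightarrow>
      \<exists>x c'. offline k N (geom_weight \<beta>) c (concat (map snd bs)) x c' \<and>
      x \<le> real \<beta> ^ (k - 1) * phases {..<N} {} (map fst bs) + length bs * (?C * real \<beta> ^ (k - 1) / \<beta>)"
      using offline_phases[OF k N2 R _ N_ne, of bs] by (metis DiffD1 lessThan_iff)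
    \<comment> \<open>The initial relocation of the heaviest server accounts for the summand 1 next
      to the number of phases.\<close>
    define c1 where "c1 = ?c0(k - 1 := y)"
    have c1: "valid_config k N c1" "c1 (k - 1) = y" using y N2 by (auto simp: c1_def valid_config_def)
    obtain x c' where x: "offline k N (geom_weight \<beta>) c1 (concat (map snd bs)) x c'"
      "x \<le> real \<beta> ^ (k - 1) * phases {..<N} {} (map fst bs) + length bs * (?C * real \<beta> ^ (k - 1) / \<beta>)"
      using off[OF c1] by blast
    have "move_cost k (geom_weight \<beta>) ?c0 c1 \<le> real \<beta> ^ (k - 1)"
      unfolding c1_def by (rule move_cost_fun_upd_le) simp
    then have "move_cost k (geom_weight \<beta>) ?c0 c1 + x \<le>
        real \<beta> ^ (k - 1) * (1 + phases {..<N} {} (map fst bs)) + T * (?C * real \<beta> ^ (k - 1) / \<beta>)"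
      using x(2) set_replicate_pmfD(1)[OF bs] by (simp add: algebra_simps)
    then show ?thesis using offline.move[OF c1(1) x(1), of ?c0] by blast
  qed
  moreover have "0 \<le> opt_cost k N (geom_weight \<beta>) ?c0 \<sigma>" if \<sigma>: "\<sigma> \<in> set_pmf p" for \<sigma>
  proof -
    obtain bs where "bs \<in> set_pmf (replicate_pmf T B)" "\<sigma> = concat (map snd bs)"
      using \<sigma> unfolding p_def set_map_pmf by blast
    with off show ?thesis by (metis opt_cost_nonneg of_nat_0_le_iff zero_le_power)
  qed
  moreover have "measure_pmf.expectation p (opt_cost k N (geom_weight \<beta>) ?c0) \<le>
      real \<beta> ^ (k - 1) * (1 + T / (N * harm n)) + T * (?C * real \<beta> ^ (k - 1) / \<beta>)"
  proof -
    have "measure_pmf.expectation p (opt_cost k N (geom_weight \<beta>) ?c0) =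
        measure_pmf.expectation (replicate_pmf T B) (\<lambda>bs. opt_cost k N (geom_weight \<beta>) ?c0 (concat (map snd bs)))"
      by (simp add: p_def)
    also have "\<dots> \<le> measure_pmf.expectation (replicate_pmf T B) (\<lambda>bs.
        real \<beta> ^ (k - 1) * (1 + phases {..<N} {} (map fst bs)) + T * (?C * real \<beta> ^ (k - 1) / \<beta>))"
    proof (rule expectation_mono_pmf[OF finBT])
      fix bs assume "bs \<in> set_pmf (replicate_pmf T B)"
      then obtain x c' where "offline k N (geom_weight \<beta>) ?c0 (concat (map snd bs)) x c'"
        "x \<le> real \<beta> ^ (k - 1) * (1 + phases {..<N} {} (map fst bs)) + T * (?C * real \<beta> ^ (k - 1) / \<beta>)"
        using off by blast
      then show "opt_cost k N (geom_weight \<beta>) ?c0 (concat (map snd bs)) \<le>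
        real \<beta> ^ (k - 1) * (1 + phases {..<N} {} (map fst bs)) + T * (?C * real \<beta> ^ (k - 1) / \<beta>)"
        using opt_cost_le_offline[of k N "geom_weight \<beta>" ?c0] by fastforce
    qed
    also have "\<dots> = real \<beta> ^ (k - 1) * (1 + measure_pmf.expectation (replicate_pmf T B)
        (\<lambda>bs. real (phases {..<N} {} (map fst bs)))) + T * (?C * real \<beta> ^ (k - 1) / \<beta>)"
      by (simp add: integrable_measure_pmf_finite[OF finBT])
    also have "measure_pmf.expectation (replicate_pmf T B) (\<lambda>bs. real (phases {..<N} {} (map fst bs))) =
        measure_pmf.expectation (map_pmf (map fst) (replicate_pmf T B)) (\<lambda>ps. real (phases {..<N} {} ps))"
      by simp
    also have "map_pmf (map fst) (replicate_pmf T B) = replicate_pmf T (pmf_of_set {..<N})"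
      by (simp only: map_replicate_pmf fstB U_def)
    also have "measure_pmf.expectation \<dots> (\<lambda>ps. real (phases {..<N} {} ps)) \<le> T / (N * harm n)"
      using expectation_phases_le[OF n1 N_ne[unfolded N_def Suc_eq_plus1[symmetric]], of T] by (simp add: N_def)
    finally show ?thesis by (simp add: mult_left_mono)
  qed
  ultimately show ?thesis by blast
qed

section \<open>Choice of \<open>\<beta>\<close> and of the number of blocks\<close>

theorem theorem2:
  fixes k :: nat and \<alpha> :: real
  assumes "k \<ge> 1" and "\<alpha> < harm (nseq (k - 1))"
  shows "\<exists>\<beta>::nat. \<beta> > 0 \<and>
    \<not> (\<exists>M. rand_alg k (nseq (k - 1) + 1) M \<and>
           competitive k (nseq (k - 1) + 1) (\<lambda>i. real \<beta> ^ i) M \<alpha>)"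
proof -
  define n where "n = nseq (k - 1)"
  define N where "N = n + 1"
  define C where "C = offline_const (k - 1)"
  \<comment> \<open>A nonnegative factor is needed to multiply the upper bound on the expected
    optimum, and \<open>\<alpha>\<close> may be negative.\<close>
  define a where "a = max \<alpha> 0"
  have hn: "harm n > (0::real)" unfolding n_def using nseq_pos[of "k - 1"] by (intro harm_pos) simp
  have N: "N > 0" by (simp add: N_def)
  have a: "0 \<le> a" "\<alpha> \<le> a" "a < harm n" using assms hn by (auto simp: a_def n_def)
  \<comment> \<open>Online bound minus \<open>a\<close> times the offline bound, per block and in
    units of \<open>\<beta> ^ (k - 1)\<close>, without the initial relocation. For
    \<open>\<beta>\<close> to infinity it tends to \<open>(1 - a / harm n) / N > 0\<close>.\<close>
  define gap where "gap \<beta> = (1 - 1 / real \<beta>) / N - a * (1 / (N * harm n) + C / real \<beta>)" for \<beta>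
  have inv: "(\<lambda>\<beta>. c / real \<beta>) \<longlonglongrightarrow> 0" for c :: real
    by (rule lim_const_over_n)
  have "gap \<longlonglongrightarrow> (1 - 0) / N - a * (1 / (N * harm n) + 0)"
    unfolding gap_def using N by (intro tendsto_intros inv) auto
  moreover have "(1 - 0) / N - a * (1 / (N * harm n) + 0) > 0"
    using a hn N by (simp add: field_simps)
  ultimately have "\<forall>\<^sub>F \<beta> in sequentially. gap \<beta> > 0" by (rule order_tendstoD)
  then have "\<forall>\<^sub>F \<beta> in sequentially. gap \<beta> > 0 \<and> \<beta> \<ge> 1"
    by (intro eventually_conj eventually_ge_at_top)
  then obtain \<beta> where \<beta>: "gap \<beta> > 0" "\<beta> \<ge> 1"
    using eventually_happens[of _ sequentially] by auto
  \<comment> \<open>With \<open>\<beta>\<close> fixed, enough blocks outweigh the one-time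
    relocation, which contributes \<open>a\<close> in these units.\<close>
  obtain T :: nat where T: "a < T * gap \<beta>" using reals_Archimedean3[OF \<beta>(1)] by blast
  have "\<not> (rand_alg k N M \<and> competitive k N (geom_weight \<beta>) M \<alpha>)" for M
  proof
    assume M: "rand_alg k N M \<and> competitive k N (geom_weight \<beta>) M \<alpha>"
    let ?c0 = "\<lambda>_::nat. 0::nat"
    obtain p where p: "finite (set_pmf p)" "\<And>\<sigma>. \<sigma> \<in> set_pmf p \<Longrightarrow> set \<sigma> \<subseteq> {..<N}"
      "\<And>A. online_alg k N A \<Longrightarrow> real T * (real \<beta> ^ (k - 1) * (1 - 1 / \<beta>) / N) \<le>
        measure_pmf.expectation p (alg_cost k (geom_weight \<beta>) A ?c0)"
      "\<And>\<sigma>. \<sigma> \<in> set_pmf p \<Longrightarrow> 0 \<le> opt_cost k N (geom_weight \<beta>) ?c0 \<sigma>"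
      "measure_pmf.expectation p (opt_cost k N (geom_weight \<beta>) ?c0) \<le>
        real \<beta> ^ (k - 1) * (1 + T / (N * harm n)) + T * (C * real \<beta> ^ (k - 1) / \<beta>)"
      using hard_distribution[OF assms(1) \<beta>(2), of T] unfolding n_def[symmetric] N_def[symmetric] C_def[symmetric]
      by blast
    have "valid_config k N ?c0" using N by (simp add: valid_config_def)
    then have "real T * (real \<beta> ^ (k - 1) * (1 - 1 / \<beta>) / N) \<le>
        \<alpha> * measure_pmf.expectation p (opt_cost k N (geom_weight \<beta>) ?c0)"
      using competitive_expected_cost[OF _ _ p(1,2) _ p(3)] M by blast
    also have "\<dots> \<le> a * measure_pmf.expectation p (opt_cost k N (geom_weight \<beta>) ?c0)"
      using a p(4) by (intro mult_right_mono integral_nonneg_AE) (auto simp: AE_measure_pmf_iff)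
    also have "\<dots> \<le> a * (real \<beta> ^ (k - 1) * (1 + T / (N * harm n)) + T * (C * real \<beta> ^ (k - 1) / \<beta>))"
      using a p(5) by (intro mult_left_mono)
    finally have "real \<beta> ^ (k - 1) * (T * ((1 - 1 / \<beta>) / N)) \<le>
        real \<beta> ^ (k - 1) * (a * (1 + T / (N * harm n) + T * (C / \<beta>)))"
      by (simp add: algebra_simps)
    then have "T * ((1 - 1 / \<beta>) / N) \<le> a * (1 + T / (N * harm n) + T * (C / \<beta>))"
      using \<beta>(2) by (simp del: times_divide_eq_right)
    then have "T * gap \<beta> \<le> a" by (simp add: gap_def algebra_simps)
    with T show False by simp
  qed
  then show ?thesis using \<beta>(2) unfolding N_def n_def by (intro exI[of _ \<beta>]) auto
qed

end
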